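(* Suppose that the proportion of matroids with ground set $\{1,\dots,n\}$ that are paving tends to $1$ as $n\to\infty$. Then there is a function $\epsilon(n)$ with $\epsilon(n)\to 0$ as $n\to\infty$ such that the proportion of matroids $M$ with ground set $\{1,\dots,n\}$ that admit a $(1+\epsilon(n))$-competitive matroid secretary algorithm tends to $1$ as $n\to\infty$.
   Context: A rank-$r$ matroid is paving if all its circuits have cardinality at least $r$. Matroid secretary problem: a matroid $M$ with ground set $E$ is known in advance; an unknown weight function $w\colon E\to\mathbb{R}_{\ge 0}$ is given. The elements of $E$ are revealed one at a time in a uniformly random order; when $e$ is revealed, $w(e)$ is learned and the algorithm must irrevocably decide whether to select $e$, subject to the selected set always being independent in $M$. The algorithm may use internal randomness. The value of the algorithm on $(M,w)$ is the expected weight of the selected set (over the random order and internal randomness). $\mathrm{opt}(M,w)$ is the maximum weight of an independent set of $M$. For $c\ge1$, an algorithm is $c$-competitive for $M$ if its value is at least $\tfrac1c\mathrm{opt}(M,w)$ for every $w$. *)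

theory Defs
  imports "HOL-Probability.Probability" "HOL-Combinatorics.Multiset_Permutations"
begin

text \<open>A matroid is given by its ground set \<open>E\<close> and the family \<open>\<I>\<close> of its independent sets.\<close>

locale matroid =
  fixes E :: "'a set" and \<I> :: "'a set set"
  assumes finite_ground: "finite E"
    and indep_subset_ground: "X \<in> \<I> \<Longrightarrow> X \<subseteq> E"
    and indep_empty: "{} \<in> \<I>"
    and indep_subset: "X \<in> \<I> \<Longrightarrow> Y \<subseteq> X \<Longrightarrow> Y \<in> \<I>"
    and indep_augment: "X \<in> \<I> \<Longrightarrow> Y \<in> \<I> \<Longrightarrow> card X < card Y \<Longrightarrow> \<exists>y \<in> Y - X. insert y X \<in> \<I>"

definition matroid_rank :: "'a set set \<Rightarrow> nat" where
  "matroid_rank \<I> = Max (card ` \<I>)"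

definition circuit :: "'a set \<Rightarrow> 'a set set \<Rightarrow> 'a set \<Rightarrow> bool" where
  "circuit E \<I> C \<longleftrightarrow> C \<subseteq> E \<and> C \<notin> \<I> \<and> (\<forall>D. D \<subset> C \<longrightarrow> D \<in> \<I>)"

definition paving :: "'a set \<Rightarrow> 'a set set \<Rightarrow> bool" where
  "paving E \<I> \<longleftrightarrow> (\<forall>C. circuit E \<I> C \<longrightarrow> matroid_rank \<I> \<le> card C)"

text \<open>Matroids are counted as labelled objects, that is, not up to isomorphism.\<close>

definition matroid_proportion :: "'a set \<Rightarrow> ('a set set \<Rightarrow> bool) \<Rightarrow> real" where
  "matroid_proportion E P =
     real (card {\<I>. matroid E \<I> \<and> P \<I>}) / real (card {\<I>. matroid E \<I>})"

text \<open>A history lists the elements revealed so far together with their weights, in order of arrival;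
  its last entry is the element about which a decision is due.
  A policy is the algorithm for a fixed outcome of its internal randomness: it maps the current
  history to the decision whether to select the last element. Earlier decisions need not be part
  of the history because the policy determines them.\<close>

type_synonym 'a history = "('a \<times> real) list"
type_synonym 'a policy = "'a history \<Rightarrow> bool"

definition reveal :: "('a \<Rightarrow> real) \<Rightarrow> 'a list \<Rightarrow> 'a history" where
  "reveal w xs = map (\<lambda>e. (e, w e)) xs"

definition selected :: "'a policy \<Rightarrow> 'a history \<Rightarrow> 'a set" where
  "selected d h = {fst (h ! i) | i. i < length h \<and> d (take (Suc i) h)}"

text \<open>A randomized algorithm draws a seed \<open>s\<close> from a probability space \<open>R\<close>, independently of the
  arrival order, and then follows the policy \<open>A s\<close>. Real seeds are no restriction: there are
  finitely many decisions, so a single uniformly distributed real number supplies all the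
  randomness that can be used. Independence is required after every step of every run.\<close>

definition secretary_algorithm ::
  "'a set \<Rightarrow> 'a set set \<Rightarrow> real measure \<Rightarrow> (real \<Rightarrow> 'a policy) \<Rightarrow> bool" where
  "secretary_algorithm E \<I> R A \<longleftrightarrow>
     prob_space R \<and>
     (\<forall>h. (\<lambda>s. A s h) \<in> measurable R (count_space UNIV)) \<and>
     (\<forall>s \<in> space R. \<forall>w. (\<forall>e \<in> E. 0 \<le> w e) \<longrightarrow>
        (\<forall>xs \<in> permutations_of_set E. \<forall>k \<le> length xs.
           selected (A s) (reveal w (take k xs)) \<in> \<I>))"

definition algorithm_value ::
  "'a set \<Rightarrow> real measure \<Rightarrow> (real \<Rightarrow> 'a policy) \<Rightarrow> ('a \<Rightarrow> real) \<Rightarrow> real" where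
  "algorithm_value E R A w =
     measure_pmf.expectation (pmf_of_set (permutations_of_set E))
       (\<lambda>xs. \<integral>s. (\<Sum>e \<in> selected (A s) (reveal w xs). w e) \<partial>R)"

definition opt :: "'a set set \<Rightarrow> ('a \<Rightarrow> real) \<Rightarrow> real" where
  "opt \<I> w = Max ((\<lambda>X. \<Sum>e \<in> X. w e) ` \<I>)"

text \<open>Only meaningful for \<open>c \<ge> 1\<close>.\<close>

definition competitive ::
  "real \<Rightarrow> 'a set \<Rightarrow> 'a set set \<Rightarrow> real measure \<Rightarrow> (real \<Rightarrow> 'a policy) \<Rightarrow> bool" where
  "competitive c E \<I> R A \<longleftrightarrow>
     (\<forall>w. (\<forall>e \<in> E. 0 \<le> w e) \<longrightarrow> algorithm_value E R A w \<ge> 1 / c * opt \<I> w)"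

definition admits_competitive_algorithm :: "real \<Rightarrow> 'a set \<Rightarrow> 'a set set \<Rightarrow> bool" where
  "admits_competitive_algorithm c E \<I> \<longleftrightarrow>
     (\<exists>R A. secretary_algorithm E \<I> R A \<and> competitive c E \<I> R A)"

end

theory Submission imports Defs begin

text \<open>In a paving matroid of rank \<open>k + 1\<close> every set of at most \<open>k\<close> elements is independent, and
  discarding one element of an optimal basis costs little when \<open>k\<close> is large. So it suffices to
  select \<open>k\<close> elements whose expected weight is almost that of the \<open>k\<close> heaviest ones. For this, a
  small fraction \<open>p\<close> of the elements is observed without selecting, and a later element is selected
  if slightly fewer than \<open>p * k\<close> observed elements beat it; by Chebyshev's inequality, with
  high probability almost all of the \<open>k\<close> heaviest later elements qualify and at most \<open>k\<close> elements do.
  Finally, matroids of bounded rank are negligible: at most \<open>2 ^ ((n + 1) ^ k)\<close> have rank at most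
  \<open>k\<close>, while sparse paving matroids of rank \<open>k + 2\<close> already number at least \<open>2\<close> to the power
  \<open>(n choose (k + 2)) / n\<close>.\<close>

section \<open>Uniformly random arrival orders\<close>

text \<open>Relabelling by a permutation of \<open>E\<close> is a bijection of the arrival orders;
  the moment computations below rest on this symmetry.\<close>

lemma sum_permutations_relabel:
  assumes "\<pi> permutes E"
  shows "(\<Sum>xs\<in>permutations_of_set E. g xs) = (\<Sum>xs\<in>permutations_of_set E. g (map \<pi> xs))"
proof -
  have "bij_betw (map \<pi>) (permutations_of_set E) (permutations_of_set E)"
  proof (rule bij_betw_imageI)
    show "inj_on (map \<pi>) (permutations_of_set E)"
      using permutes_inj[OF assms] by (metis inj_mapI inj_on_subset subset_UNIV)
    show "map \<pi> ` permutations_of_set E = permutations_of_set E"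
      using permutations_of_set_image_inj[of \<pi> E] permutes_inj_on[OF assms] permutes_image[OF assms]
      by metis
  qed
  then show ?thesis
    using sum.reindex_bij_betw[of "map \<pi>" _ _ g] by simp
qed

text \<open>Real-valued, so that moments of the sample count are plain sums over arrival orders. The
  sample consists of the first \<open>m\<close> arrivals.\<close>

definition in_sample :: "nat \<Rightarrow> 'a \<Rightarrow> 'a list \<Rightarrow> real" where
  "in_sample m e xs = of_bool (e \<in> set (take m xs))"

lemma in_sample_map:
  assumes "inj \<pi>"
  shows "in_sample m (\<pi> e) (map \<pi> xs) = in_sample m e xs"
  using assms by (auto simp: in_sample_def take_map inj_def)

lemma sum_in_sample:
  assumes "finite T"
  shows "(\<Sum>e\<in>T. in_sample m e xs) = real (card (set (take m xs) \<inter> T))"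
  using assms by (simp add: in_sample_def sum.If_cases of_bool_def Int_commute Collect_mem_eq)

lemma card_sample:
  assumes "xs \<in> permutations_of_set E" "m \<le> card E"
  shows "card (set (take m xs)) = m"
proof -
  have "distinct xs" "length xs = card E"
    using assms(1) by (auto simp: permutations_of_set_def distinct_card)
  then show ?thesis
    using assms(2) by (simp add: distinct_card)
qed

lemma sample_subset: "xs \<in> permutations_of_set E \<Longrightarrow> set (take m xs) \<subseteq> E"
  by (auto simp: permutations_of_set_def dest: in_set_takeD)

text \<open>By transpositions the sum is the same for all elements of \<open>E\<close>, and every
  order samples exactly \<open>m\<close> of them, so double counting determines it.\<close>

lemma sum_in_sample_permutations:
  assumes fin: "finite E" and e: "e \<in> E" and m: "m \<le> card E"
  shows "(\<Sum>xs\<in>permutations_of_set E. in_sample m e xs) = fact (card E) * (real m / real (card E))"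
proof -
  let ?\<Omega> = "permutations_of_set E"
  have sym: "(\<Sum>xs\<in>?\<Omega>. in_sample m f xs) = (\<Sum>xs\<in>?\<Omega>. in_sample m e xs)" if f: "f \<in> E" for f
  proof -
    have p: "Transposition.transpose e f permutes E"
      using e f by (simp add: permutes_swap_id)
    show ?thesis
      using sum_permutations_relabel[OF p, of "in_sample m f"]
        in_sample_map[OF permutes_inj[OF p], of m e] by simp
  qed
  have "real (card E) * (\<Sum>xs\<in>?\<Omega>. in_sample m e xs) = (\<Sum>f\<in>E. \<Sum>xs\<in>?\<Omega>. in_sample m f xs)"
    using sym by simp
  also have "\<dots> = (\<Sum>xs\<in>?\<Omega>. real (card (set (take m xs) \<inter> E)))"
    by (subst sum.swap) (simp add: sum_in_sample fin)
  also have "\<dots> = (\<Sum>xs\<in>?\<Omega>. real m)"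
    by (intro sum.cong refl) (simp add: Int_absorb2[OF sample_subset] card_sample[OF _ m])
  also have "\<dots> = fact (card E) * real m"
    using fin by simp
  finally have "real (card E) * (\<Sum>xs\<in>?\<Omega>. in_sample m e xs) = fact (card E) * real m" .
  moreover have "real (card E) \<noteq> 0"
    using e fin by auto
  ultimately show ?thesis
    by (simp add: field_simps)
qed

text \<open>Double counting over ordered pairs of distinct elements gives m(m-1)/(n(n-1)) times
  \<open>fact (card E)\<close>, where n is \<open>card E\<close>. Sampling without replacement is
  not positively correlated, whence the bound by the independent value.\<close>

lemma sum_in_sample_pair_permutations:
  assumes fin: "finite E" and e: "e \<in> E" "f \<in> E" "e \<noteq> f" and m: "m \<le> card E"
  shows "(\<Sum>xs\<in>permutations_of_set E. in_sample m e xs * in_sample m f xs)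
    \<le> fact (card E) * (real m / real (card E))\<^sup>2"
proof -
  let ?\<Omega> = "permutations_of_set E" and ?n = "real (card E)"
  define c where "c = (\<Sum>xs\<in>?\<Omega>. in_sample m e xs * in_sample m f xs)"
  have sym: "(\<Sum>xs\<in>?\<Omega>. in_sample m e' xs * in_sample m f' xs) = c"
    if ef: "e' \<in> E" "f' \<in> E" "e' \<noteq> f'" for e' f'
  proof -
    define g where "g = Transposition.transpose e e' f"
    \<comment> \<open>The first transposition takes \<open>e\<close> to \<open>e'\<close> and
      \<open>f\<close> to \<open>g\<close>; the second takes \<open>g\<close> to \<open>f'\<close>
      and fixes \<open>e'\<close>, which differs from both.\<close>
    define \<pi> where "\<pi> = Transposition.transpose g f' \<circ> Transposition.transpose e e'"
    have g: "g \<in> E" "g \<noteq> e'"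
      using e ef by (auto simp: g_def Transposition.transpose_def)
    have p: "\<pi> permutes E"
      unfolding \<pi>_def using e ef g by (intro permutes_compose permutes_swap_id) auto
    have "\<pi> e = e'" "\<pi> f = f'"
      using g ef by (auto simp: \<pi>_def g_def[symmetric])
    then show ?thesis
      unfolding c_def
      using sum_permutations_relabel[OF p, of "\<lambda>xs. in_sample m e' xs * in_sample m f' xs"]
        in_sample_map[OF permutes_inj[OF p], of m e] in_sample_map[OF permutes_inj[OF p], of m f]
      by simp
  qed
  have n2: "?n \<ge> 2"
    using card_mono[OF fin, of "{e, f}"] e by auto
  have "?n * (?n - 1) * c = (\<Sum>e'\<in>E. \<Sum>f'\<in>E - {e'}. c)"
    using n2 fin by (simp add: of_nat_diff)
  also have "\<dots> = (\<Sum>e'\<in>E. \<Sum>f'\<in>E - {e'}. \<Sum>xs\<in>?\<Omega>. in_sample m e' xs * in_sample m f' xs)"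
    by (intro sum.cong refl sym[symmetric]) auto
  also have "\<dots> = (\<Sum>xs\<in>?\<Omega>. \<Sum>e'\<in>E. \<Sum>f'\<in>E - {e'}. in_sample m e' xs * in_sample m f' xs)"
    by (subst sum.swap, subst (2) sum.swap) (rule refl)
  also have "\<dots> = (\<Sum>xs\<in>?\<Omega>. real m * (real m - 1))"
  proof (rule sum.cong[OF refl])
    fix xs assume xs: "xs \<in> ?\<Omega>"
    have Z: "(\<Sum>e'\<in>E. in_sample m e' xs) = real m"
      using sample_subset[OF xs] card_sample[OF xs m] fin by (simp add: sum_in_sample Int_absorb2)
    have sq: "in_sample m e' xs * in_sample m e' xs = in_sample m e' xs" for e'
      by (simp add: in_sample_def)
    have "(\<Sum>e'\<in>E. \<Sum>f'\<in>E - {e'}. in_sample m e' xs * in_sample m f' xs)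
        = (\<Sum>e'\<in>E. in_sample m e' xs * real m - in_sample m e' xs)"
      using fin Z by (intro sum.cong) (simp_all add: sum_distrib_left[symmetric] sum_diff1 right_diff_distrib sq)
    also have "\<dots> = real m * real m - real m"
      by (simp add: sum_subtractf sum_distrib_right[symmetric] Z)
    finally show "(\<Sum>e'\<in>E. \<Sum>f'\<in>E - {e'}. in_sample m e' xs * in_sample m f' xs)
        = real m * (real m - 1)"
      by (simp add: algebra_simps)
  qed
  also have "\<dots> = fact (card E) * (real m * (real m - 1))"
    using fin by simp
  finally have "c = fact (card E) * (real m * (real m - 1) / (?n * (?n - 1)))"
    using n2 by (simp add: field_simps)
  also have "real m * (real m - 1) / (?n * (?n - 1)) \<le> (real m / ?n)\<^sup>2"
  proof -
    \<comment> \<open>The two sides differ by m(n - m).\<close>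
    have "real m * (real m - 1) * ?n \<le> real m * real m * (?n - 1)"
      using m by (simp add: algebra_simps mult_mono)
    then have "real m * (real m - 1) * ?n * ?n \<le> real m * real m * (?n - 1) * ?n"
      by (rule mult_right_mono) simp
    then show ?thesis
      using n2 by (simp add: power2_eq_square field_simps)
  qed
  finally show ?thesis
    by (simp add: c_def mult_left_mono)
qed

text \<open>Since pairs are not positively correlated, the variance of the number of sampled
  elements of \<open>T\<close> is at most its mean. Sums over orders stand for expectations, hence
  the factor \<open>fact (card E)\<close>.\<close>

lemma sample_variance:
  assumes fin: "finite E" and T: "T \<subseteq> E" and m: "m \<le> card E"
  defines "p \<equiv> real m / real (card E)"
  shows "(\<Sum>xs\<in>permutations_of_set E. (real (card (set (take m xs) \<inter> T)) - p * card T)\<^sup>2)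
    \<le> fact (card E) * (p * card T)"
proof -
  let ?\<Omega> = "permutations_of_set E" and ?N = "fact (card E) :: real" and ?t = "real (card T)"
  have finT: "finite T"
    using T fin finite_subset by blast
  define Z where "Z xs = (\<Sum>e\<in>T. in_sample m e xs)" for xs
  have Z1: "(\<Sum>xs\<in>?\<Omega>. Z xs) = ?N * (p * ?t)"
  proof -
    have "(\<Sum>xs\<in>?\<Omega>. Z xs) = (\<Sum>e\<in>T. \<Sum>xs\<in>?\<Omega>. in_sample m e xs)"
      unfolding Z_def by (rule sum.swap)
    also have "\<dots> = (\<Sum>e\<in>T. ?N * p)"
      unfolding p_def using T m by (intro sum.cong refl sum_in_sample_permutations fin) auto
    finally show ?thesis by simp
  qed
  have sq: "in_sample m e xs * in_sample m e xs = in_sample m e xs" for e xs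
    by (simp add: in_sample_def)
  have "(\<Sum>xs\<in>?\<Omega>. (Z xs)\<^sup>2) = (\<Sum>xs\<in>?\<Omega>. \<Sum>e\<in>T. \<Sum>f\<in>T. in_sample m e xs * in_sample m f xs)"
    by (simp add: Z_def power2_eq_square sum_product)
  also have "\<dots> = (\<Sum>e\<in>T. \<Sum>f\<in>T. \<Sum>xs\<in>?\<Omega>. in_sample m e xs * in_sample m f xs)"
    by (subst sum.swap, subst (2) sum.swap) (rule refl)
  also have "\<dots> = (\<Sum>e\<in>T. (\<Sum>xs\<in>?\<Omega>. in_sample m e xs)
      + (\<Sum>f\<in>T-{e}. \<Sum>xs\<in>?\<Omega>. in_sample m e xs * in_sample m f xs))"
    by (intro sum.cong refl) (simp add: sum.remove[OF finT] sq)
  also have "\<dots> \<le> (\<Sum>e\<in>T. ?N * p + (\<Sum>f\<in>T-{e}. ?N * p\<^sup>2))"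
    unfolding p_def using T m
    by (intro sum_mono add_mono sum_in_sample_pair_permutations fin
      eq_refl[OF sum_in_sample_permutations]) auto
  also have "\<dots> = ?N * (p * ?t + ?t * (?t - 1) * p\<^sup>2)"
  \<comment> \<open>The inner sum has \<open>card T - 1\<close> terms, a natural subtraction that
    truncates for empty \<open>T\<close>.\<close>
  proof (cases "card T = 0")
    case True then show ?thesis using finT by simp
  next
    case False
    then have "real (card T - Suc 0) = ?t - 1" by simp
    then show ?thesis using finT by (simp add: algebra_simps)
  qed
  finally have Z2: "(\<Sum>xs\<in>?\<Omega>. (Z xs)\<^sup>2) \<le> ?N * (p * ?t + ?t * (?t - 1) * p\<^sup>2)" .
  have "(\<Sum>xs\<in>?\<Omega>. (Z xs - p * ?t)\<^sup>2)
      = (\<Sum>xs\<in>?\<Omega>. (Z xs)\<^sup>2) - 2 * (p * ?t) * (\<Sum>xs\<in>?\<Omega>. Z xs) + ?N * (p * ?t)\<^sup>2"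
    using fin by (simp add: power2_diff sum.distrib sum_subtractf sum_distrib_left algebra_simps)
  also have "\<dots> \<le> ?N * (p * ?t + ?t * (?t - 1) * p\<^sup>2) - 2 * (p * ?t) * (?N * (p * ?t)) + ?N * (p * ?t)\<^sup>2"
    using Z2 Z1 by simp
  also have "\<dots> = ?N * (p * ?t) - ?N * (p\<^sup>2 * ?t)"
    by (simp add: algebra_simps power2_eq_square)
  also have "\<dots> \<le> ?N * (p * ?t)"
    by simp
  finally show ?thesis
    by (simp add: Z_def sum_in_sample[OF finT])
qed

text \<open>Chebyshev's inequality in counting form: each counted order contributes at least the
  square of \<delta> to the sum bounded in \<open>sample_variance\<close>.\<close>

lemma sample_chebyshev:
  assumes fin: "finite E" and T: "T \<subseteq> E" and m: "m \<le> card E" and \<delta>: "\<delta> > 0"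
  defines "p \<equiv> real m / real (card E)"
  shows "real (card {xs \<in> permutations_of_set E. \<delta> \<le> \<bar>real (card (set (take m xs) \<inter> T)) - p * card T\<bar>})
    \<le> fact (card E) * (p * card T / \<delta>\<^sup>2)"
proof -
  let ?\<Omega> = "permutations_of_set E"
  let ?D = "\<lambda>xs. real (card (set (take m xs) \<inter> T)) - p * card T"
  let ?B = "{xs \<in> ?\<Omega>. \<delta> \<le> \<bar>?D xs\<bar>}"
  have "real (card ?B) * \<delta>\<^sup>2 = (\<Sum>xs\<in>?B. \<delta>\<^sup>2)"
    by simp
  also have "\<dots> \<le> (\<Sum>xs\<in>?B. (?D xs)\<^sup>2)"
  proof (rule sum_mono)
    fix xs assume "xs \<in> ?B"
    then show "\<delta>\<^sup>2 \<le> (?D xs)\<^sup>2"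
      using \<delta> abs_le_square_iff[of \<delta> "?D xs"] by simp
  qed
  also have "\<dots> \<le> (\<Sum>xs\<in>?\<Omega>. (?D xs)\<^sup>2)"
    by (intro sum_mono2) auto
  also have "\<dots> \<le> fact (card E) * (p * card T)"
    using sample_variance[OF fin T m] by (simp add: p_def)
  finally show ?thesis
    using \<delta> by (simp add: field_simps)
qed

section \<open>Selecting almost the best \<open>k\<close> elements\<close>

text \<open>Ties between weights are broken by the order of the ground set.\<close>

definition better :: "('a::linorder \<Rightarrow> real) \<Rightarrow> 'a \<Rightarrow> 'a \<Rightarrow> bool" where
  "better w f e \<longleftrightarrow> w e < w f \<or> (w e = w f \<and> e < f)"

lemma better_trans: "better w g f \<Longrightarrow> better w f e \<Longrightarrow> better w g e"
  and better_irrefl: "\<not> better w e e"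
  and better_linear: "e \<noteq> f \<Longrightarrow> better w e f \<or> better w f e"
  and better_imp_le: "better w f e \<Longrightarrow> w e \<le> w f"
  by (auto simp: better_def)

definition top_elements :: "('a::linorder \<Rightarrow> real) \<Rightarrow> 'a set \<Rightarrow> nat \<Rightarrow> 'a set" where
  "top_elements w E a = {e \<in> E. card {f \<in> E. better w f e} < a}"

lemma top_elements_subset: "top_elements w E a \<subseteq> E"
  by (auto simp: top_elements_def)

lemma card_better_less:
  assumes "finite E" "f \<in> E" "better w f e"
  shows "card {g \<in> E. better w g f} < card {g \<in> E. better w g e}"
proof (rule psubset_card_mono)
  have "{g \<in> E. better w g f} \<subseteq> {g \<in> E. better w g e}"
    using better_trans[OF _ assms(3)] by auto
  moreover have "f \<in> {g \<in> E. better w g e} - {g \<in> E. better w g f}"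
    using assms better_irrefl by auto
  ultimately show "{g \<in> E. better w g f} \<subset> {g \<in> E. better w g e}"
    by blast
qed (use assms in simp)

lemma better_in_top_elements:
  assumes "finite E" "e \<in> top_elements w E a" "f \<in> E" "better w f e"
  shows "f \<in> top_elements w E a"
  using assms card_better_less[OF assms(1,3,4)] by (auto simp: top_elements_def)

lemma top_elements_better:
  assumes "finite E" "e \<in> E - top_elements w E a" "f \<in> top_elements w E a"
  shows "better w f e"
proof -
  have "e \<noteq> f" "\<not> better w e f"
    using assms better_in_top_elements[OF assms(1) assms(3), of e] by auto
  then show ?thesis
    using better_linear by blast
qed

text \<open>The number of better elements is injective on \<open>E\<close> with values below
  \<open>card E\<close>, hence a bijection onto \<open>{..<card E}\<close>; the top elements are the
  preimage of \<open>{..<a}\<close>.\<close>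

lemma card_top_elements:
  assumes fin: "finite E" and a: "a \<le> card E"
  shows "card (top_elements w E a) = a"
proof -
  define rk where "rk e = card {f \<in> E. better w f e}" for e
  have inj: "inj_on rk E"
    unfolding rk_def
  proof (rule inj_onI)
    fix e f assume "e \<in> E" "f \<in> E" and eq: "card {g \<in> E. better w g e} = card {g \<in> E. better w g f}"
    then show "e = f"
      using better_linear[of e f w] card_better_less[OF fin, of e w f] card_better_less[OF fin, of f w e]
      by auto
  qed
  have "rk e < card E" if "e \<in> E" for e
    unfolding rk_def using that better_irrefl by (intro psubset_card_mono fin) auto
  then have "rk ` E = {..<card E}"
    using inj by (intro card_subset_eq) (auto simp: card_image)
  then have "rk ` top_elements w E a = {..<a}"
    using a unfolding top_elements_def rk_def[symmetric] by (auto simp: image_def set_eq_iff) (metis less_le_trans)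
  then show ?thesis
    using inj inj_on_subset[OF inj top_elements_subset] by (metis card_image card_lessThan)
qed

text \<open>Let \<open>v\<close> be the least weight among the top \<open>b\<close>: what
  \<open>X\<close> has outside them weighs at most \<open>v\<close> apiece, what they have outside
  \<open>X\<close> at least \<open>v\<close>. This compares an optimal independent set with slightly
  fewer top elements.\<close>

lemma sum_le_top_elements:
  assumes fin: "finite E" and X: "X \<subseteq> E" "card X \<le> r" and b: "b \<le> r" "b \<le> card E"
    and w: "\<forall>e\<in>E. 0 \<le> w e"
  shows "real b * sum w X \<le> real r * sum w (top_elements w E b)"
proof (cases "b = 0")
  case True
  then show ?thesis
    using w top_elements_subset[of w E b] by (auto intro!: mult_nonneg_nonneg sum_nonneg)
next
  case False
  let ?T = "top_elements w E b"
  have T: "finite ?T" "card ?T = b" "?T \<subseteq> E"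
    using fin b card_top_elements top_elements_subset finite_subset by metis+
  have finX: "finite X"
    using X fin finite_subset by blast
  define v where "v = Min (w ` ?T)"
  have ne: "w ` ?T \<noteq> {}"
    using T False by auto
  have v: "v \<in> w ` ?T" "\<And>e. e \<in> ?T \<Longrightarrow> v \<le> w e"
    unfolding v_def using T ne by auto
  have v0: "0 \<le> v"
    using v(1) w T by auto
  have out: "w e \<le> v" if "e \<in> E - ?T" for e
    using v(1) top_elements_better[OF fin that] better_imp_le by fastforce
  define s where "s = sum w (X \<inter> ?T)"
  define c where "c = card (X \<inter> ?T)"
  have cb: "c \<le> b"
    unfolding c_def using card_mono[OF T(1), of "X \<inter> ?T"] T(2) by simp
  have s: "real c * v \<le> s"
    unfolding s_def c_def using sum_mono[of "X \<inter> ?T" "\<lambda>_. v" w] v(2) by simp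
  have "card (X - ?T) + c \<le> r"
    unfolding c_def using X card_Diff_subset_Int[of X ?T] finX card_mono[OF finX, of "X \<inter> ?T"] by simp
  then have cX: "real (card (X - ?T)) \<le> real r - real c"
    by linarith
  have "sum w X = s + sum w (X - ?T)"
    unfolding s_def using sum.Int_Diff[OF finX] by blast
  moreover have "sum w (X - ?T) \<le> real (card (X - ?T)) * v"
    using sum_bounded_above[of "X - ?T" w v] out X by auto
  moreover have "\<dots> \<le> (real r - real c) * v"
    using cX v0 by (intro mult_right_mono)
  ultimately have 1: "sum w X \<le> s + (real r - real c) * v"
    by linarith
  have "sum w ?T = s + sum w (?T - X)"
    unfolding s_def using sum.Int_Diff[OF T(1), of w X] by (simp add: Int_commute)
  moreover have "real (card (?T - X)) * v \<le> sum w (?T - X)"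
    using sum_mono[of "?T - X" "\<lambda>_. v" w] v(2) by simp
  moreover have "real (card (?T - X)) = real b - real c"
    using card_Diff_subset_Int[of ?T X] T cb by (simp add: c_def Int_commute of_nat_diff)
  ultimately have 2: "s + (real b - real c) * v \<le> sum w ?T"
    by simp
  \<comment> \<open>The two sides of the inequality derived from this one differ by
    \<open>(real r - real b) * (s - real c * v)\<close>.\<close>
  have "(real r - real b) * (real c * v) \<le> (real r - real b) * s"
    using s b by (intro mult_left_mono) auto
  then have "real b * (s + (real r - real c) * v) \<le> real r * (s + (real b - real c) * v)"
    by (simp add: algebra_simps)
  moreover have "real b * sum w X \<le> real b * (s + (real r - real c) * v)"
    using 1 by (intro mult_left_mono) auto
  moreover have "real r * (s + (real b - real c) * v) \<le> real r * sum w ?T"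
    using 2 by (intro mult_left_mono) auto
  ultimately show ?thesis
    by linarith
qed

section \<open>The threshold policy and its selections\<close>

text \<open>Positions below \<open>m\<close> form the sample and never pass. The test refers to
  positions because a policy sees only the history; its disjunction is \<open>better\<close>
  unfolded. The threshold \<tau> is real because it will be a fraction of an expected count.\<close>

definition passes :: "nat \<Rightarrow> real \<Rightarrow> 'a::linorder history \<Rightarrow> nat \<Rightarrow> bool" where
  "passes m \<tau> h i \<longleftrightarrow> m \<le> i \<and>
     real (card {l. l < m \<and> (snd (h ! i) < snd (h ! l) \<or>
       (snd (h ! i) = snd (h ! l) \<and> fst (h ! i) < fst (h ! l)))}) < \<tau>"

text \<open>Counting the earlier passing entries is the same as counting the earlier selections, as long
  as the quota is not exhausted.\<close>

definition threshold_policy :: "nat \<Rightarrow> real \<Rightarrow> nat \<Rightarrow> 'a::linorder policy" where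
  "threshold_policy m \<tau> k h \<longleftrightarrow> passes m \<tau> h (length h - 1) \<and>
     card {i. i < length h - 1 \<and> passes m \<tau> h i} < k"

text \<open>Passing at \<open>i\<close> depends only on the sample and on entry \<open>i\<close>, so
  the verdict reached online agrees with that on the full history.\<close>

lemma passes_take: "i < j \<Longrightarrow> passes m \<tau> (take j h) i = passes m \<tau> h i"
proof (cases "m \<le> i")
  case True
  moreover assume "i < j"
  ultimately have "l < m \<Longrightarrow> take j h ! l = h ! l" "take j h ! i = h ! i" for l
    by simp_all
  then show ?thesis
    by (simp add: passes_def cong: conj_cong)
qed (simp add: passes_def)

lemma selected_threshold_policy:
  "selected (threshold_policy m \<tau> k) h =
    {fst (h ! i) | i. i < length h \<and> passes m \<tau> h i \<and> card {l. l < i \<and> passes m \<tau> h l} < k}"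
proof -
  have "threshold_policy m \<tau> k (take (Suc i) h) \<longleftrightarrow>
      passes m \<tau> h i \<and> card {l. l < i \<and> passes m \<tau> h l} < k" if "i < length h" for i
  proof -
    have "length (take (Suc i) h) - 1 = i"
      using that by simp
    then show ?thesis
      unfolding threshold_policy_def
      by (simp add: passes_take cong: conj_cong)
  qed
  then show ?thesis
    unfolding selected_def by blast
qed

text \<open>All members other than the largest are among its fewer than \<open>k\<close>
  predecessors satisfying \<open>P\<close>. This enforces the quota in every run, whatever the
  weights.\<close>

lemma card_first_le:
  fixes P :: "nat \<Rightarrow> bool"
  shows "card {i. i < N \<and> P i \<and> card {l. l < i \<and> P l} < k} \<le> k"
proof (rule ccontr)
  let ?J = "{i. i < N \<and> P i \<and> card {l. l < i \<and> P l} < k}"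
  assume *: "\<not> card ?J \<le> k"
  have fin: "finite ?J" by simp
  define i where "i = Max ?J"
  have "?J \<noteq> {}"
    using * by (metis card.empty zero_le)
  then have i: "i \<in> ?J"
    unfolding i_def by (intro Max_in fin)
  have "?J - {i} \<subseteq> {l. l < i \<and> P l}"
  proof
    fix l assume "l \<in> ?J - {i}"
    then show "l \<in> {l. l < i \<and> P l}"
      using Max_ge[OF fin, of l] by (auto simp: i_def[symmetric])
  qed
  then have "card (?J - {i}) \<le> card {l. l < i \<and> P l}"
    by (intro card_mono) auto
  then have "card ?J - 1 \<le> card {l. l < i \<and> P l}"
    using i by (simp add: card_Diff_singleton)
  moreover have "card {l. l < i \<and> P l} < k"
    using i by simp
  ultimately show False
    using * by linarith
qed

lemma card_selected_threshold_policy: "card (selected (threshold_policy m \<tau> k) h) \<le> k"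
proof -
  let ?J = "{i. i < length h \<and> passes m \<tau> h i \<and> card {l. l < i \<and> passes m \<tau> h l} < k}"
  have "selected (threshold_policy m \<tau> k) h = (\<lambda>i. fst (h ! i)) ` ?J"
    unfolding selected_threshold_policy by blast
  then show ?thesis
    using card_image_le[of ?J "\<lambda>i. fst (h ! i)"] card_first_le[of "length h" "passes m \<tau> h" k]
    by simp
qed

lemma selected_reveal_subset: "selected d (reveal w xs) \<subseteq> set xs"
  by (auto simp: selected_def reveal_def)

text \<open>Moves from positions to elements; as the order has no repetitions, counting positions
  equals counting elements.\<close>

lemma passes_reveal:
  assumes xs: "distinct xs" and m: "m \<le> length xs" and i: "i < length xs"
  shows "passes m \<tau> (reveal w xs) i \<longleftrightarrow>
    xs ! i \<notin> set (take m xs) \<and> real (card {f \<in> set (take m xs). better w f (xs ! i)}) < \<tau>"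
proof -
  have S: "set (take m xs) = (!) xs ` {..<m}"
    using m by (simp add: nth_image[symmetric] lessThan_atLeast0)
  have inj: "inj_on ((!) xs) {..<length xs}"
    using xs by (auto simp: inj_on_def nth_eq_iff_index_eq)
  have "xs ! i \<in> set (take m xs) \<longleftrightarrow> i < m"
    using S inj i m by (auto dest: inj_onD[OF inj])
  moreover have "{f \<in> set (take m xs). better w f (xs ! i)}
      = (!) xs ` {l. l < m \<and> better w (xs ! l) (xs ! i)}"
    unfolding S by auto
  moreover have "inj_on ((!) xs) {l. l < m \<and> better w (xs ! l) (xs ! i)}"
    using m by (intro inj_on_subset[OF inj]) auto
  moreover have "{l. l < m \<and> (snd (reveal w xs ! i) < snd (reveal w xs ! l) \<or>
       (snd (reveal w xs ! i) = snd (reveal w xs ! l) \<and> fst (reveal w xs ! i) < fst (reveal w xs ! l)))}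
      = {l. l < m \<and> better w (xs ! l) (xs ! i)}"
    using m i by (auto simp: reveal_def better_def)
  ultimately show ?thesis
    unfolding passes_def by (simp add: card_image not_less)
qed

text \<open>If the sample holds at least \<open>\<tau>\<close> of the \<open>k\<close> best elements, only these can pass, so the
  quota is never exhausted; if it holds fewer than \<open>\<tau>\<close> of the \<open>b\<close> best, all of these pass.\<close>

lemma top_elements_selected:
  assumes fin: "finite E" and xs: "xs \<in> permutations_of_set E" and m: "m \<le> card E"
    and k: "k \<le> card E"
    and A: "real (card (set (take m xs) \<inter> top_elements w E b)) < \<tau>"
    and B: "\<tau> \<le> real (card (set (take m xs) \<inter> top_elements w E k))"
  shows "top_elements w E b - set (take m xs) \<subseteq> selected (threshold_policy m \<tau> k) (reveal w xs)"
proof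
  let ?S = "set (take m xs)"
  have x: "distinct xs" "set xs = E" "length xs = card E"
    using xs by (auto simp: permutations_of_set_def distinct_card)
  have S: "?S \<subseteq> E" "finite ?S"
    using sample_subset[OF xs] by auto
  note pass = passes_reveal[OF x(1) m[folded x(3)], of _ \<tau> w]
  fix e assume e: "e \<in> top_elements w E b - ?S"
  then have "e \<in> set xs"
    using x top_elements_subset by blast
  then obtain i where i: "i < length xs" "xs ! i = e"
    by (auto simp: in_set_conv_nth)
  have "{f \<in> ?S. better w f e} \<subseteq> ?S \<inter> top_elements w E b"
    using better_in_top_elements[OF fin, of e w b] e S by auto
  then have "card {f \<in> ?S. better w f e} \<le> card (?S \<inter> top_elements w E b)"
    using S by (intro card_mono) auto
  then have p: "passes m \<tau> (reveal w xs) i"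
    using pass[OF i(1)] e i A by auto
  have in_top: "xs ! l \<in> top_elements w E k" if l: "l < length xs" "passes m \<tau> (reveal w xs) l" for l
  proof (rule ccontr)
    assume nt: "xs ! l \<notin> top_elements w E k"
    have "xs ! l \<in> E" using l x by auto
    then have "?S \<inter> top_elements w E k \<subseteq> {f \<in> ?S. better w f (xs ! l)}"
      using nt top_elements_better[OF fin, of "xs ! l" w k] by auto
    then have "card (?S \<inter> top_elements w E k) \<le> card {f \<in> ?S. better w f (xs ! l)}"
      using S by (intro card_mono) auto
    then show False
      using pass[OF l(1)] l(2) B by auto
  qed
  let ?L = "{l. l < i \<and> passes m \<tau> (reveal w xs) l}"
  \<comment> \<open>Position \<open>i\<close> and the earlier passing positions yield distinct
    elements of the top \<open>k\<close>, so fewer than \<open>k\<close> positions passed before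
    \<open>i\<close> and the quota is still open.\<close>
  have "card (insert i ?L) = card ((!) xs ` insert i ?L)"
    using x i by (intro card_image[symmetric]) (auto simp: inj_on_def nth_eq_iff_index_eq)
  also have "\<dots> \<le> card (top_elements w E k)"
    using in_top i p fin finite_subset[OF top_elements_subset fin] by (intro card_mono) auto
  also have "\<dots> = k"
    using card_top_elements[OF fin k] .
  finally have "card ?L < k"
    by simp
  moreover have "e = fst (reveal w xs ! i)" "i < length (reveal w xs)"
    using i by (simp_all add: reveal_def)
  ultimately show "e \<in> selected (threshold_policy m \<tau> k) (reveal w xs)"
    unfolding selected_threshold_policy using p by blast
qed

text \<open>The threshold lies \<open>\<eta> * p * k\<close> below the mean \<open>p * k\<close> of
  sampled top \<open>k\<close> elements and at least as far above the mean \<open>p * b\<close> of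
  sampled top \<open>b\<close> elements. Chebyshev bounds each of these two bad events, whence the
  numerator 2; the term \<open>p\<close> is the expected share of the top \<open>b\<close> lost to
  the sample.\<close>

lemma sum_selected_threshold_policy:
  fixes E :: "'a::linorder set" and m k b :: nat
  assumes fin: "finite E" and m: "m \<le> card E" and k: "k \<le> card E" and b: "b \<le> card E"
    and \<eta>: "0 < \<eta>" and bk: "real b \<le> (1 - 2 * \<eta>) * real k"
    and w: "\<forall>e\<in>E. 0 \<le> w e"
  defines "p \<equiv> real m / real (card E)"
  assumes p: "0 < p"
  shows "fact (card E) * ((1 - p - 2 / (\<eta>\<^sup>2 * p * k)) * sum w (top_elements w E b))
    \<le> (\<Sum>xs\<in>permutations_of_set E.
        sum w (selected (threshold_policy m ((1 - \<eta>) * p * k) k) (reveal w xs)))"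
\<comment> \<open>For \<open>k = 0\<close> the Chebyshev margin would vanish, but then
  \<open>b = 0\<close> and the left side is zero.\<close>
proof (cases "k = 0")
  case True
  then have "top_elements w E b = {}"
    using bk by (auto simp: top_elements_def)
  then show ?thesis
    using True by (auto intro!: sum_nonneg) (metis (no_types) permutations_of_setD(1) selected_reveal_subset subsetD w)
next
  case False
  let ?\<Omega> = "permutations_of_set E" and ?N = "fact (card E) :: real"
  let ?T = "\<lambda>a. top_elements w E a" and ?S = "\<lambda>xs. set (take m xs)"
  define \<tau> where "\<tau> = (1 - \<eta>) * p * k"
  define \<delta> where "\<delta> = \<eta> * p * k"
  have \<delta>: "\<delta> > 0"
    using False \<eta> p by (simp add: \<delta>_def)
  define bad where "bad a = {xs \<in> ?\<Omega>. \<delta> \<le> \<bar>real (card (?S xs \<inter> ?T a)) - p * card (?T a)\<bar>}" for a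
  have bad: "real (card (bad a)) \<le> ?N * (1 / (\<eta>\<^sup>2 * p * k))" if a: "a \<le> card E" "real a \<le> k" for a
  proof -
    have "real (card (bad a)) \<le> ?N * (p * a / \<delta>\<^sup>2)"
      using sample_chebyshev[OF fin top_elements_subset[of w E a] m \<delta>] card_top_elements[OF fin a(1), of w]
      by (simp add: bad_def p_def)
    also have "p * a / \<delta>\<^sup>2 \<le> p * k / \<delta>\<^sup>2"
      using a p by (intro divide_right_mono mult_left_mono) auto
    also have "p * k / \<delta>\<^sup>2 = 1 / (\<eta>\<^sup>2 * p * k)"
      using False \<eta> p by (simp add: \<delta>_def power2_eq_square field_simps)
    finally show ?thesis
      by (simp add: mult_left_mono)
  qed
  have "0 \<le> \<eta> * real k"
    using \<eta> by simp
  then have "real b \<le> real k"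
    using bk by (simp add: algebra_simps)
  define good where "good xs = (xs \<notin> bad b \<and> xs \<notin> bad k)" for xs
  have sel: "sum w (?T b - ?S xs) \<le> sum w (selected (threshold_policy m \<tau> k) (reveal w xs))"
    if xs: "xs \<in> ?\<Omega>" "good xs" for xs
  proof -
    have "\<bar>real (card (?S xs \<inter> ?T b)) - p * b\<bar> < \<delta>" "\<bar>real (card (?S xs \<inter> ?T k)) - p * k\<bar> < \<delta>"
      using xs card_top_elements[OF fin b, of w] card_top_elements[OF fin k, of w]
      by (auto simp: good_def bad_def)
    moreover have "p * b \<le> p * ((1 - 2 * \<eta>) * k)"
      using bk p by (intro mult_left_mono) auto
    ultimately have "real (card (?S xs \<inter> ?T b)) < \<tau>" "\<tau> \<le> real (card (?S xs \<inter> ?T k))"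
      unfolding \<tau>_def \<delta>_def by (auto simp: algebra_simps abs_less_iff)
    then have sub: "?T b - ?S xs \<subseteq> selected (threshold_policy m \<tau> k) (reveal w xs)"
      by (intro top_elements_selected[OF fin xs(1) m k])
    have E: "selected (threshold_policy m \<tau> k) (reveal w xs) \<subseteq> E"
      using selected_reveal_subset[of _ w xs] xs(1) by (auto simp: permutations_of_set_def)
    show ?thesis
      using sub E w finite_subset[OF E fin] by (intro sum_mono2) auto
  qed
  have nonneg: "0 \<le> sum w (selected (threshold_policy m \<tau> k) (reveal w xs))" if "xs \<in> ?\<Omega>" for xs
    using selected_reveal_subset[of "threshold_policy m \<tau> k" w xs] that w
    by (intro sum_nonneg) (auto simp: permutations_of_set_def)
  have finT: "finite (?T b)"
    using finite_subset[OF top_elements_subset fin] .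
  \<comment> \<open>A bad order is charged the full weight of the top \<open>b\<close>, which makes
    its bound at most zero. The estimate thus holds for every order, and averaging needs no
    conditioning.\<close>
  have point: "sum w (?T b) - (\<Sum>e\<in>?T b. w e * in_sample m e xs)
      - (of_bool (xs \<in> bad b) + of_bool (xs \<in> bad k)) * sum w (?T b)
      \<le> sum w (selected (threshold_policy m \<tau> k) (reveal w xs))" if xs: "xs \<in> ?\<Omega>" for xs
  proof -
    have diff: "sum w (?T b) - (\<Sum>e\<in>?T b. w e * in_sample m e xs) = sum w (?T b - ?S xs)"
    proof -
      have "(\<Sum>e\<in>?T b. w e * in_sample m e xs) = sum w (?T b \<inter> ?S xs)"
        using finT by (simp add: in_sample_def sum.inter_restrict if_distrib of_bool_def cong: if_cong)
      then show ?thesis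
        using sum.Int_Diff[OF finT, of w "?S xs"] by simp
    qed
    have T0: "0 \<le> sum w (?T b)"
      using w top_elements_subset[of w E b] by (intro sum_nonneg) auto
    have TS: "sum w (?T b - ?S xs) \<le> sum w (?T b)"
      using w top_elements_subset[of w E b] finT by (intro sum_mono2) auto
    show ?thesis
    proof (cases "good xs")
      case True
      then show ?thesis
        using sel[OF xs] diff by (simp add: good_def)
    next
      case False
      then show ?thesis
        using nonneg[OF xs] T0 TS diff by (auto simp: good_def)
    qed
  qed
  have count: "(\<Sum>xs\<in>?\<Omega>. of_bool (xs \<in> bad a)) = real (card (bad a))" for a
    by (auto simp: bad_def of_bool_def sum.If_cases Int_def)
  have T0: "0 \<le> sum w (?T b)"
    using w top_elements_subset[of w E b] by (intro sum_nonneg) auto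
  have "(\<Sum>xs\<in>?\<Omega>. \<Sum>e\<in>?T b. w e * in_sample m e xs) = (\<Sum>e\<in>?T b. w e * (?N * p))"
    unfolding p_def
    using sum_in_sample_permutations[OF fin _ m] top_elements_subset[of w E b]
    by (subst sum.swap) (auto simp: sum_distrib_left[symmetric] intro!: sum.cong)
  also have "\<dots> = ?N * p * sum w (?T b)"
    by (simp add: sum_distrib_left mult_ac)
  finally have eq: "(\<Sum>xs\<in>?\<Omega>. sum w (?T b) - (\<Sum>e\<in>?T b. w e * in_sample m e xs)
      - (of_bool (xs \<in> bad b) + of_bool (xs \<in> bad k)) * sum w (?T b))
    = ?N * sum w (?T b) - ?N * p * sum w (?T b)
      - (real (card (bad b)) + real (card (bad k))) * sum w (?T b)"
    using fin by (simp add: sum_subtractf sum_distrib_right[symmetric] sum.distrib count)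
  have "?N * (2 / D) = ?N * (1 / D) + ?N * (1 / D)" for D :: real
    by (simp add: mult.commute)
  then have "real (card (bad b)) + real (card (bad k)) \<le> ?N * (2 / (\<eta>\<^sup>2 * p * k))"
    using add_mono[OF bad[OF b \<open>real b \<le> real k\<close>] bad[OF k order_refl]] by metis
  then have "(real (card (bad b)) + real (card (bad k))) * sum w (?T b)
      \<le> (?N * (2 / (\<eta>\<^sup>2 * p * k))) * sum w (?T b)"
    using T0 by (rule mult_right_mono)
  then have "?N * ((1 - p - 2 / (\<eta>\<^sup>2 * p * k)) * sum w (?T b))
    \<le> ?N * sum w (?T b) - ?N * p * sum w (?T b)
      - (real (card (bad b)) + real (card (bad k))) * sum w (?T b)"
    by (simp add: algebra_simps)
  also have "\<dots> \<le> (\<Sum>xs\<in>?\<Omega>. sum w (selected (threshold_policy m \<tau> k) (reveal w xs)))"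
    unfolding eq[symmetric] by (intro sum_mono point)
  finally show ?thesis
    by (simp add: \<tau>_def)
qed

section \<open>Paving matroids of large rank\<close>

lemma (in matroid) finite_family: "finite \<I>"
  using finite_ground indep_subset_ground by (meson PowI finite_Pow_iff finite_subset subsetI)

lemma (in matroid) card_indep_le_rank: "X \<in> \<I> \<Longrightarrow> card X \<le> matroid_rank \<I>"
  unfolding matroid_rank_def using finite_family by simp

lemma (in matroid) rank_le_card: "matroid_rank \<I> \<le> card E"
proof -
  have "matroid_rank \<I> \<in> card ` \<I>"
    unfolding matroid_rank_def using finite_family indep_empty by (intro Max_in) auto
  then show ?thesis
    using card_mono[OF finite_ground] indep_subset_ground by auto
qed

text \<open>A dependent \<open>X\<close> would contain a minimal dependent set, a circuit smaller
  than the rank. Hence a policy with quota one below the rank is always feasible.\<close>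

lemma (in matroid) paving_indep:
  assumes "paving E \<I>" and X: "X \<subseteq> E" "card X < matroid_rank \<I>"
  shows "X \<in> \<I>"
proof (rule ccontr)
  assume "X \<notin> \<I>"
  have "\<exists>C. C \<subseteq> X \<and> C \<notin> \<I> \<and> (\<forall>D. D \<subset> C \<longrightarrow> D \<in> \<I>)"
    using finite_subset[OF X(1) finite_ground] \<open>X \<notin> \<I>\<close>
  proof (induction X rule: finite_psubset_induct)
    case (psubset X)
    show ?case
    proof (cases "\<forall>D. D \<subset> X \<longrightarrow> D \<in> \<I>")
      case True
      then show ?thesis using psubset.prems by blast
    next
      case False
      then obtain D where D: "D \<subset> X" "D \<notin> \<I>" by blast
      obtain C where "C \<subseteq> D" "C \<notin> \<I>" "\<forall>D. D \<subset> C \<longrightarrow> D \<in> \<I>"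
        using psubset.IH[OF D] by (elim exE conjE)
      then show ?thesis
        using D(1) by (intro exI[of _ C]) auto
    qed
  qed
  then obtain C where C: "C \<subseteq> X" "circuit E \<I> C"
    using X unfolding circuit_def by blast
  then have "matroid_rank \<I> \<le> card C"
    using assms(1) by (simp add: paving_def)
  also have "card C \<le> card X"
    using C(1) X(1) finite_ground finite_subset card_mono by metis
  finally show False
    using X by simp
qed

lemma (in matroid) opt_attained:
  obtains X where "X \<in> \<I>" "opt \<I> w = sum w X"
proof -
  have "opt \<I> w \<in> sum w ` \<I>"
    unfolding opt_def using finite_family indep_empty by (intro Max_in) auto
  then show ?thesis
    using that by auto
qed

text \<open>A deterministic policy enters the randomized model through a point mass on the
  seed.\<close>

lemma algorithm_value_deterministic:
  assumes "finite E"
  shows "algorithm_value E (return (count_space UNIV) 0) (\<lambda>_. d) w =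
    (\<Sum>xs\<in>permutations_of_set E. sum w (selected d (reveal w xs))) / fact (card E)"
proof -
  interpret prob_space "return (count_space UNIV) (0::real)"
    by (rule prob_space_return) simp
  show ?thesis
    unfolding algorithm_value_def using assms prob_space
    by (simp add: integral_pmf_of_set)
qed

text \<open>Sampling costs at most 1/q since p is at most 1/q; the bad events cost at most 1/q since
  p is at least 1/(2q) and \<open>k\<close> at least 4q^4; replacing an optimal set of at most
  \<open>Suc k\<close> elements by the top \<open>b\<close> costs at most 3/q. Finally (1 - 2/q)(1 -
  3/q) \<ge> 1 - 5/q.\<close>

lemma competitive_ratio_arith:
  fixes q k n m b :: nat and W opt' :: real
  assumes q: "q \<ge> 5" and k: "4 * q ^ 4 \<le> k" and n: "k < n"
    and m: "m = n div q" and b: "b = nat \<lfloor>(1 - 2 * (1 / real q)) * real k\<rfloor>"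
    and W: "real b * opt' \<le> real (Suc k) * W" and opt': "0 \<le> opt'" "0 \<le> W"
  defines "p \<equiv> real m / real n"
  shows "0 < p" and "(1 - 5 / real q) * opt' \<le> (1 - p - 2 / ((1 / real q)\<^sup>2 * p * k)) * W"
proof -
  let ?q = "real q"
  have q0: "?q \<ge> 5" using q by simp
  have "q ^ 1 \<le> q ^ 4"
    using q by (intro power_increasing) auto
  then have kq: "4 * q \<le> k"
    using k by simp
  \<comment> \<open>The remainder is below \<open>q\<close>, hence at most half of \<open>n\<close>,
    so rounding down \<open>m\<close> loses at most a factor of two.\<close>
  have "real n = real q * real m + real (n mod q)"
    unfolding m by (metis mult_div_mod_eq of_nat_add of_nat_mult)
  moreover have "real (n mod q) < ?q"
    using q by simp
  moreover have "2 * ?q \<le> real n"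
    using kq n by linarith
  ultimately have mn: "?q * real m \<le> real n" "real n \<le> 2 * ?q * real m"
    by linarith+
  have n0: "real n > 0" using n by simp
  have p1: "p \<le> 1 / ?q" and p2: "1 / (2 * ?q) \<le> p"
    using mn n0 q0 by (auto simp: p_def field_simps)
  show p0: "0 < p"
    using p2 q0 by (meson divide_pos_pos less_le_trans mult_pos_pos zero_less_numeral zero_less_one order_less_le_trans)
  have k0: "real k > 0" using kq q by simp
  have "2 / ((1 / ?q)\<^sup>2 * p * k) \<le> 2 / ((1 / ?q)\<^sup>2 * (1 / (2 * ?q)) * k)"
    using p2 p0 k0 q0 by (intro divide_left_mono mult_right_mono mult_left_mono mult_pos_pos) auto
  also have "\<dots> = 4 * ?q ^ 3 / k"
    using q0 k0 by (simp add: field_simps power2_eq_square power3_eq_cube)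
  also have "\<dots> \<le> 1 / ?q"
  proof -
    have "4 * ?q ^ 4 \<le> real k"
      using k by (metis of_nat_le_iff of_nat_mult of_nat_numeral of_nat_power)
    then show ?thesis
      using q0 k0 by (simp add: field_simps power3_eq_cube power4_eq_xxxx)
  qed
  finally have c1: "1 - 2 / ?q \<le> 1 - p - 2 / ((1 / ?q)\<^sup>2 * p * k)"
    using p1 by (simp add: field_simps)
  have "real b \<ge> (1 - 2 * (1 / ?q)) * real k - 1"
    unfolding b by linarith
  moreover have "(1 - 2 * (1 / ?q)) * real k - 1 \<ge> (1 - 3 / ?q) * real (Suc k)"
  proof -
    \<comment> \<open>The third 1/q contributes k/q \<ge> 4, which absorbs the rounding of
      \<open>b\<close> and the passage from \<open>k\<close> to \<open>Suc k\<close>.\<close>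
    have eq: "(1 - 2 * (1 / ?q)) * real k - 1 - (1 - 3 / ?q) * real (Suc k) = real k / ?q - 2 + 3 / ?q"
      using q0 by (simp add: field_simps)
    have nonneg: "3 / ?q \<ge> 0"
      using q0 by simp
    have "real k / ?q \<ge> 4"
      using kq q0 by (simp add: field_simps)
    then show ?thesis
      using eq nonneg by linarith
  qed
  ultimately have "(1 - 3 / ?q) * real (Suc k) * opt' \<le> real (Suc k) * W"
    using W mult_right_mono[of "(1 - 3 / ?q) * real (Suc k)" "real b" opt'] opt' by linarith
  then have W': "(1 - 3 / ?q) * opt' \<le> W"
    by (simp add: mult.assoc mult.left_commute)
  have "(1 - 5 / ?q) * opt' \<le> (1 - 2 / ?q) * ((1 - 3 / ?q) * opt')"
  proof -
    have "1 - 5 / ?q \<le> (1 - 2 / ?q) * (1 - 3 / ?q)"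
      by (simp add: algebra_simps)
    then show ?thesis
      using opt' by (metis mult.assoc mult_right_mono)
  qed
  also have "\<dots> \<le> (1 - 2 / ?q) * W"
    using W' q0 by (intro mult_left_mono) auto
  also have "\<dots> \<le> (1 - p - 2 / ((1 / ?q)\<^sup>2 * p * k)) * W"
    using c1 opt' by (intro mult_right_mono)
  finally show "(1 - 5 / ?q) * opt' \<le> (1 - p - 2 / ((1 / ?q)\<^sup>2 * p * k)) * W" .
qed

lemma paving_admits_competitive_algorithm:
  fixes E :: "'a::linorder set" and M :: nat
  assumes mat: "matroid E \<I>" and pav: "paving E \<I>"
    and rank: "4 * (5 * (M + 2)) ^ 4 < matroid_rank \<I>"
  shows "admits_competitive_algorithm (1 + 1 / real (Suc M)) E \<I>"
proof -
  interpret matroid E \<I> by fact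
  \<comment> \<open>One below the rank: paving guarantees independence only for sets smaller than
    the rank.\<close>
  define k where "k = matroid_rank \<I> - 1"
  \<comment> \<open>Chosen so that 1 - 5/q = (M + 1)/(M + 2), the reciprocal of the target
    ratio.\<close>
  define q where "q = 5 * (M + 2)"
  define m where "m = card E div q"
  define b where "b = nat \<lfloor>(1 - 2 * (1 / real q)) * real k\<rfloor>"
  define p where "p = real m / real (card E)"
  define d :: "'a policy" where "d = threshold_policy m ((1 - 1 / real q) * p * k) k"
  have k: "4 * q ^ 4 \<le> k" "Suc k = matroid_rank \<I>"
    using rank unfolding k_def q_def by linarith+
  have n: "k < card E"
    using k rank_le_card by linarith
  have q: "q \<ge> 5" by (simp add: q_def)
  have "(1 - 2 * (1 / real q)) * real k \<ge> 0"
    using q by (intro mult_nonneg_nonneg) auto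
  then have bk: "real b \<le> (1 - 2 * (1 / real q)) * real k"
    unfolding b_def by (simp add: of_nat_nat)
  also have "\<dots> \<le> 1 * real k"
    by (intro mult_right_mono) auto
  finally have bk': "b \<le> k" by simp
  have m: "m \<le> card E" by (simp add: m_def)
  have sel: "selected d (reveal w (take j xs)) \<in> \<I>" if "xs \<in> permutations_of_set E" for w j xs
  proof (rule paving_indep[OF pav])
    show "selected d (reveal w (take j xs)) \<subseteq> E"
      using selected_reveal_subset sample_subset[OF that] by (rule subset_trans)
    show "card (selected d (reveal w (take j xs))) < matroid_rank \<I>"
      using card_selected_threshold_policy[of m _ k] k(2) unfolding d_def by (metis less_Suc_eq_le)
  qed
  have "secretary_algorithm E \<I> (return (count_space UNIV) 0) (\<lambda>_. d)"
    unfolding secretary_algorithm_def using sel by (auto intro: prob_space_return)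
  moreover have "competitive (1 + 1 / real (Suc M)) E \<I> (return (count_space UNIV) 0) (\<lambda>_. d)"
    unfolding competitive_def
  proof (intro allI impI)
    fix w :: "'a \<Rightarrow> real"
    assume w: "\<forall>e\<in>E. 0 \<le> w e"
    let ?W = "sum w (top_elements w E b)"
    obtain X where X: "X \<in> \<I>" "opt \<I> w = sum w X"
      by (rule opt_attained)
    have XE: "X \<subseteq> E" "card X \<le> Suc k"
      using X indep_subset_ground card_indep_le_rank k by auto
    have W: "real b * opt \<I> w \<le> real (Suc k) * ?W"
      unfolding X(2) using bk' n by (intro sum_le_top_elements finite_ground XE w) auto
    have o0: "0 \<le> opt \<I> w"
      unfolding X(2) using w XE by (intro sum_nonneg) auto
    have W0: "0 \<le> ?W"
      using w top_elements_subset[of w E b] by (intro sum_nonneg) auto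
    note ratio = competitive_ratio_arith[OF q k(1) n m_def b_def W o0 W0, folded p_def]
    have "1 / (1 + 1 / real (Suc M)) = 1 - 5 / real q"
      by (simp add: q_def field_simps)
    then have "1 / (1 + 1 / real (Suc M)) * opt \<I> w
        \<le> (1 - p - 2 / ((1 / real q)\<^sup>2 * p * k)) * ?W"
      using ratio(2) by simp
    also have "fact (card E) * \<dots> \<le> (\<Sum>xs\<in>permutations_of_set E. sum w (selected d (reveal w xs)))"
      unfolding d_def p_def
      using n bk bk' m q ratio(1) by (intro sum_selected_threshold_policy finite_ground w) (auto simp: p_def)
    then have "(1 - p - 2 / ((1 / real q)\<^sup>2 * p * k)) * ?W
        \<le> algorithm_value E (return (count_space UNIV) 0) (\<lambda>_. d) w"
      by (simp add: algorithm_value_deterministic[OF finite_ground] field_simps)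
    finally show "1 / (1 + 1 / real (Suc M)) * opt \<I> w
        \<le> algorithm_value E (return (count_space UNIV) 0) (\<lambda>_. d) w" .
  qed
  ultimately show ?thesis
    unfolding admits_competitive_algorithm_def by blast
qed

section \<open>Matroids of small rank are rare\<close>

text \<open>The sets in \<open>\<H>\<close> are the circuit-hyperplanes of a sparse paving matroid.\<close>

lemma matroid_sparse_paving:
  assumes fin: "finite E" and r: "0 < r"
    and H: "\<And>A. A \<in> \<H> \<Longrightarrow> card A = r"
    and sep: "\<And>C a b. insert a C \<in> \<H> \<Longrightarrow> insert b C \<in> \<H> \<Longrightarrow> a \<notin> C \<Longrightarrow> b \<notin> C \<Longrightarrow> a = b"
  shows "matroid E {X. X \<subseteq> E \<and> card X \<le> r \<and> X \<notin> \<H>}"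
proof
  show "finite E" by fact
  show "{} \<in> {X. X \<subseteq> E \<and> card X \<le> r \<and> X \<notin> \<H>}"
    using H r by fastforce
  show "X \<in> {X. X \<subseteq> E \<and> card X \<le> r \<and> X \<notin> \<H>} \<Longrightarrow> X \<subseteq> E" for X
    by simp
  show "Y \<in> {X. X \<subseteq> E \<and> card X \<le> r \<and> X \<notin> \<H>}"
    if X: "X \<in> {X. X \<subseteq> E \<and> card X \<le> r \<and> X \<notin> \<H>}" and Y: "Y \<subseteq> X" for X Y
  proof -
    have fX: "finite X"
      using X fin finite_subset by auto
    have "Y \<notin> \<H>"
    proof
      assume YH: "Y \<in> \<H>"
      then have "card X \<le> card Y" using H[OF YH] X by simp
      then have "Y = X"
        using card_seteq[OF fX Y] by simp
      then show False using YH X by simp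
    qed
    then show ?thesis
      using X Y card_mono[OF fX Y] by auto
  qed
  show "\<exists>y\<in>Y - X. insert y X \<in> {X. X \<subseteq> E \<and> card X \<le> r \<and> X \<notin> \<H>}"
    if X: "X \<in> {X. X \<subseteq> E \<and> card X \<le> r \<and> X \<notin> \<H>}"
      and Y: "Y \<in> {X. X \<subseteq> E \<and> card X \<le> r \<and> X \<notin> \<H>}" and XY: "card X < card Y" for X Y
  proof (rule ccontr)
    have fX: "finite X" and fY: "finite Y"
      using X Y fin finite_subset by auto
    assume neg: "\<not> (\<exists>y\<in>Y - X. insert y X \<in> {X. X \<subseteq> E \<and> card X \<le> r \<and> X \<notin> \<H>})"
    \<comment> \<open>\<open>X\<close> has room for one more element, so augmentation fails only
      through \<H>; \<open>sep\<close> then leaves a single candidate \<open>y\<close>, and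
      \<open>Y = insert y X\<close> would itself lie in \<H>.\<close>
    have all: "insert y X \<in> \<H>" if "y \<in> Y - X" for y
      using neg that X Y XY fX by (auto simp: card_insert_if)
    obtain y where y: "y \<in> Y - X"
      using XY fX card_mono[OF fX, of Y] by fastforce
    have "Y - X \<subseteq> {y}"
      using sep[OF all all] y by blast
    then have "Y \<subseteq> insert y X" by blast
    moreover have "card (insert y X) \<le> card Y"
      using y XY fX by simp
    ultimately have "Y = insert y X"
      using fX by (intro card_seteq) auto
    then show False
      using all[OF y] Y by simp
  qed
qed

section \<open>Counting matroids on a fixed ground set\<close>

lemma finite_matroids: "finite E \<Longrightarrow> finite {\<I>. matroid E \<I>}"
  by (rule finite_subset[of _ "Pow (Pow E)"]) (auto dest: matroid.indep_subset_ground)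

text \<open>Graham and Sloane's packing: among the \<open>r\<close>-subsets of \<open>{1..n}\<close> with a prescribed sum modulo
  \<open>n\<close>, no two differ by a single exchange.\<close>

lemma card_matroids_ge:
  assumes r: "0 < r" and n: "0 < n"
  shows "2 powr (real (n choose r) / real n) \<le> real (card {\<I>. matroid {1..n} \<I>})"
proof -
  define \<F> where "\<F> = {A. A \<subseteq> {1..n} \<and> card A = r}"
  define cls where "cls c = {A \<in> \<F>. \<Sum>A mod n = c}" for c
  have fin: "finite \<F>" unfolding \<F>_def by simp
  have cF: "card \<F> = n choose r"
    unfolding \<F>_def using n_subsets[of "{1..n}" r] by simp
  \<comment> \<open>Pigeonhole over the \<open>n\<close> residues.\<close>
  have "\<exists>c<n. real (n choose r) / real n \<le> real (card (cls c))"
  proof (rule ccontr)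
    assume "\<not> ?thesis"
    then have less: "real (card (cls c)) < real (n choose r) / real n" if "c < n" for c
      using that by auto
    have "\<F> = (\<Union>c<n. cls c)"
      using n by (auto simp: cls_def)
    then have "card \<F> \<le> (\<Sum>c<n. card (cls c))"
      using card_UN_le[of "{..<n}" cls] by simp
    then have "real (card \<F>) \<le> (\<Sum>c<n. real (card (cls c)))"
      by (metis of_nat_le_iff of_nat_sum)
    also have "\<dots> < (\<Sum>c<n. real (n choose r) / real n)"
      using less n by (intro sum_strict_mono) auto
    also have "\<dots> = real (card \<F>)"
      using n cF by simp
    finally show False by simp
  qed
  then obtain c where c: "real (n choose r) / real n \<le> real (card (cls c))"
    by blast
  have finc: "finite (cls c)" using fin by (simp add: cls_def)
  \<comment> \<open>Every subfamily of the chosen class serves as the circuit-hyperplanes of a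
    matroid, so there are at least as many matroids as subfamilies.\<close>
  define mk where "mk \<H> = {X. X \<subseteq> {1..n} \<and> card X \<le> r \<and> X \<notin> \<H>}" for \<H>
  have "matroid {1..n} (mk \<H>)" if "\<H> \<subseteq> cls c" for \<H>
    unfolding mk_def
  proof (rule matroid_sparse_paving[OF _ r])
    show "card A = r" if "A \<in> \<H>" for A
      using that \<open>\<H> \<subseteq> cls c\<close> by (auto simp: cls_def \<F>_def)
    fix C a b assume ab: "insert a C \<in> \<H>" "insert b C \<in> \<H>" "a \<notin> C" "b \<notin> C"
    then have "insert a C \<in> cls c" "insert b C \<in> cls c"
      using that by auto
    then have *: "a \<in> {1..n}" "b \<in> {1..n}" "C \<subseteq> {1..n}"
      "\<Sum>(insert a C) mod n = \<Sum>(insert b C) mod n"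
      by (auto simp: cls_def \<F>_def)
    then have fC: "finite C" using finite_subset by blast
    \<comment> \<open>Equal sums force \<open>a\<close> and \<open>b\<close> to agree modulo
      \<open>n\<close>, and both lie in \<open>{1..n}\<close>.\<close>
    have "int (\<Sum>C + a) mod int n = int (\<Sum>C + b) mod int n"
      unfolding zmod_int[symmetric] using *(4) fC ab by (simp add: add.commute)
    then have "int n dvd int a - int b"
      by (simp add: mod_eq_dvd_iff)
    moreover have "\<bar>int a - int b\<bar> < int n"
      using * by auto
    ultimately show "a = b"
      using zdvd_not_zless[of "\<bar>int a - int b\<bar>" "int n"] by fastforce
  qed simp
  moreover have "inj_on mk (Pow (cls c))"
  proof (rule inj_onI)
    fix H K assume HK: "H \<in> Pow (cls c)" "K \<in> Pow (cls c)" and eq: "mk H = mk K"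
    \<comment> \<open>Members of \<open>L\<close> have exactly \<open>r\<close> elements, so they
      are precisely the sets of at most \<open>r\<close> elements missing from
      \<open>mk L\<close>.\<close>
    have rec: "L = {X. X \<subseteq> {1..n} \<and> card X \<le> r} - mk L" if "L \<subseteq> cls c" for L
      using that by (auto simp: mk_def cls_def \<F>_def)
    show "H = K"
      using rec[of H] rec[of K] HK eq by auto
  qed
  ultimately have "card (Pow (cls c)) \<le> card {\<I>. matroid {1..n} \<I>}"
    by (intro card_inj_on_le[of mk] finite_matroids) auto
  then have "2 ^ card (cls c) \<le> real (card {\<I>. matroid {1..n} \<I>})"
    using card_Pow[OF finc] by (metis of_nat_le_iff of_nat_numeral of_nat_power)
  moreover have "2 powr (real (n choose r) / real n) \<le> 2 powr real (card (cls c))"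
    using c by simp
  moreover have "2 powr real (card (cls c)) = (2 :: real) ^ card (cls c)"
    by (simp add: powr_realpow)
  ultimately show ?thesis
    by linarith
qed

text \<open>Each binomial coefficient is at most a term of the expansion of
  \<open>(card E + 1) ^ k\<close>.\<close>

lemma card_small_subsets_le:
  assumes "finite E"
  shows "card {X. X \<subseteq> E \<and> card X \<le> k} \<le> (card E + 1) ^ k"
proof -
  have "{X. X \<subseteq> E \<and> card X \<le> k} = (\<Union>i\<le>k. {X. X \<subseteq> E \<and> card X = i})"
    by auto
  then have "card {X. X \<subseteq> E \<and> card X \<le> k} \<le> (\<Sum>i\<le>k. card {X. X \<subseteq> E \<and> card X = i})"
    using card_UN_le[of "{..k}" "\<lambda>i. {X. X \<subseteq> E \<and> card X = i}"] by simp
  also have "\<dots> = (\<Sum>i\<le>k. card E choose i)"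
    using n_subsets[OF assms] by simp
  also have "\<dots> \<le> (\<Sum>i\<le>k. (k choose i) * card E ^ i)"
  proof (rule sum_mono)
    fix i assume "i \<in> {..k}"
    then have "1 \<le> k choose i"
      by (simp add: Suc_leI)
    moreover have "card E choose i \<le> card E ^ i"
      by (cases "i \<le> card E") (auto intro: binomial_le_pow simp: binomial_eq_0)
    ultimately show "card E choose i \<le> (k choose i) * card E ^ i"
      using mult_le_mono[of 1 "k choose i" "card E choose i" "card E ^ i"] by simp
  qed
  also have "\<dots> = (card E + 1) ^ k"
    using binomial[of "card E" 1 k] by simp
  finally show ?thesis .
qed

text \<open>Such a matroid is determined by a subfamily of the sets with at most \<open>k\<close>
  elements.\<close>

lemma card_low_rank_matroids_le:
  assumes "finite E"
  shows "card {\<I>. matroid E \<I> \<and> matroid_rank \<I> \<le> k} \<le> 2 ^ ((card E + 1) ^ k)"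
proof -
  let ?S = "{X. X \<subseteq> E \<and> card X \<le> k}"
  have "{\<I>. matroid E \<I> \<and> matroid_rank \<I> \<le> k} \<subseteq> Pow ?S"
    using matroid.indep_subset_ground matroid.card_indep_le_rank le_trans by fast
  moreover have fin: "finite ?S" using assms by simp
  ultimately have "card {\<I>. matroid E \<I> \<and> matroid_rank \<I> \<le> k} \<le> card (Pow ?S)"
    by (intro card_mono) auto
  also have "\<dots> = 2 ^ card ?S"
    by (rule card_Pow[OF fin])
  also have "\<dots> \<le> 2 ^ ((card E + 1) ^ k)"
    using card_small_subsets_le[OF assms] by (intro power_increasing) auto
  finally show ?thesis .
qed

text \<open>With R = (k+2)^(k+2), the exponent of the lower bound for rank \<open>k + 2\<close> is
  at least n^(k+1)/R, against at most 2^k n^k for low rank. Rank \<open>k + 1\<close> would give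
  only order n^k, which need not win.\<close>

lemma low_rank_proportion_le:
  assumes n: "k + 2 \<le> n" "2 ^ k * (k + 2) ^ (k + 2) \<le> n"
  shows "matroid_proportion {1..n} (\<lambda>\<I>. matroid_rank \<I> \<le> k)
    \<le> 2 powr (2 ^ k - real n / real (k + 2) ^ (k + 2))"
proof -
  let ?r = "k + 2"
  let ?L = "card {\<I>. matroid {1..n} \<I> \<and> matroid_rank \<I> \<le> k}"
  let ?D = "2 powr (real (n choose ?r) / real n)"
  define R where "R = real ?r ^ ?r"
  have R: "R > 0" by (simp add: R_def)
  have n0: "real n \<ge> 1" using n by simp
  have "real ?L \<le> real (2 ^ ((n + 1) ^ k))"
    using card_low_rank_matroids_le[of "{1..n}" k] by (simp only: of_nat_le_iff) simp
  also have "\<dots> = 2 powr ((real n + 1) ^ k)"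
    using powr_realpow[of "2::real" "(n + 1) ^ k"] by (simp add: add.commute)
  finally have L: "real ?L \<le> 2 powr ((real n + 1) ^ k)" .
  have "matroid_proportion {1..n} (\<lambda>\<I>. matroid_rank \<I> \<le> k) \<le> 2 powr ((real n + 1) ^ k) / ?D"
    unfolding matroid_proportion_def using n L card_matroids_ge[of ?r n]
    by (intro frac_le) auto
  also have "\<dots> = 2 powr ((real n + 1) ^ k - real (n choose ?r) / real n)"
    by (simp add: powr_diff)
  also have "\<dots> \<le> 2 powr (2 ^ k - real n / R)"
  proof -
    have "(real n + 1) ^ k \<le> (2 * real n) ^ k"
      using n0 by (intro power_mono) auto
    then have 1: "(real n + 1) ^ k \<le> real n ^ k * 2 ^ k"
      by (simp add: power_mult_distrib mult.commute)
    have "real n ^ k * (real n / R) * real n = (real n / real ?r) ^ ?r"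
      by (simp add: R_def power_divide power_add power2_eq_square)
    also have "\<dots> \<le> real (n choose ?r)"
      using binomial_ge_n_over_k_pow_k[of ?r n, where 'a = real] n by simp
    finally have 2: "real n ^ k * (real n / R) \<le> real (n choose ?r) / real n"
      using n0 by (simp add: field_simps)
    \<comment> \<open>The second assumption makes \<open>real n / R - 2 ^ k\<close> nonnegative, so
      its factor \<open>real n ^ k\<close> may be dropped.\<close>
    have "real (2 ^ k * ?r ^ ?r) \<le> real n"
      using n(2) by (simp only: of_nat_le_iff)
    then have "2 ^ k * R \<le> real n"
      by (simp only: R_def of_nat_mult of_nat_power of_nat_numeral)
    then have "2 ^ k \<le> real n / R"
      using R by (simp add: field_simps)
    then have "1 * (real n / R - 2 ^ k) \<le> real n ^ k * (real n / R - 2 ^ k)"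
      using n0 by (intro mult_right_mono) auto
    then have "(real n + 1) ^ k - real (n choose ?r) / real n \<le> 2 ^ k - real n / R"
      using 1 2 by (simp add: algebra_simps)
    then show ?thesis by simp
  qed
  finally show ?thesis
    by (simp add: R_def)
qed

lemma low_rank_proportion_tendsto_0:
  "(\<lambda>n::nat. matroid_proportion {1..n} (\<lambda>\<I>. matroid_rank \<I> \<le> k)) \<longlonglongrightarrow> 0"
proof (rule tendsto_sandwich)
  define R where "R = real (k + 2) ^ (k + 2)"
  have R: "R > 0" by (simp add: R_def)
  show "\<forall>\<^sub>F n in sequentially. 0 \<le> matroid_proportion {1..n} (\<lambda>\<I>. matroid_rank \<I> \<le> k)"
    by (simp add: matroid_proportion_def)
  show "\<forall>\<^sub>F n in sequentially. matroid_proportion {1..n} (\<lambda>\<I>. matroid_rank \<I> \<le> k)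
      \<le> 2 powr (2 ^ k - real n / R)"
    using eventually_ge_at_top[of "k + 2"] eventually_ge_at_top[of "2 ^ k * (k + 2) ^ (k + 2)"]
    unfolding R_def by eventually_elim (rule low_rank_proportion_le)
  \<comment> \<open>The upper bound is a constant times a geometric sequence; this is its ratio,
    which is below 1.\<close>
  have "(2::real) powr (- 1 / R) < 2 powr 0"
    using R by (intro powr_less_mono) auto
  then have "(\<lambda>n. 2 powr (2 ^ k) * (2 powr (- 1 / R)) ^ n) \<longlonglongrightarrow> (2 powr (2 ^ k) * 0 :: real)"
    by (intro tendsto_mult_left LIMSEQ_power_zero) simp
  moreover have "2 powr (2 ^ k - real n / R) = 2 powr (2 ^ k) * (2 powr (- 1 / R)) ^ n" for n
    by (simp add: powr_diff powr_minus_divide powr_power power_one_over)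
  ultimately show "(\<lambda>n. 2 powr (2 ^ k - real n / R)) \<longlonglongrightarrow> 0"
    by simp
qed simp

section \<open>Proportions, limits and a diagonal choice of accuracy\<close>

lemma matroid_proportion_le_1:
  assumes "finite E"
  shows "matroid_proportion E P \<le> 1"
proof -
  have "card {\<I>. matroid E \<I> \<and> P \<I>} \<le> card {\<I>. matroid E \<I>}"
    using finite_matroids[OF assms] by (intro card_mono) auto
  then show ?thesis
    unfolding matroid_proportion_def by (intro divide_le_eq_1[THEN iffD2]) linarith
qed

lemma matroid_proportion_disj:
  assumes "finite E" and imp: "\<And>\<I>. matroid E \<I> \<Longrightarrow> P \<I> \<Longrightarrow> Q \<I> \<or> R \<I>"
  shows "matroid_proportion E P \<le> matroid_proportion E Q + matroid_proportion E R"
proof -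
  have "card {\<I>. matroid E \<I> \<and> P \<I>} \<le> card ({\<I>. matroid E \<I> \<and> Q \<I>} \<union> {\<I>. matroid E \<I> \<and> R \<I>})"
    using imp finite_matroids[OF assms(1)] by (intro card_mono) auto
  also have "\<dots> \<le> card {\<I>. matroid E \<I> \<and> Q \<I>} + card {\<I>. matroid E \<I> \<and> R \<I>}"
    by (rule card_Un_le)
  finally show ?thesis
    unfolding matroid_proportion_def add_divide_distrib[symmetric]
    by (intro divide_right_mono) (simp_all flip: of_nat_add)
qed

text \<open>For fixed \<open>M\<close> a paving matroid has rank at most the constant
  \<open>k\<close> or admits the algorithm. So the proportion is squeezed between that of paving
  matroids minus that of low rank and 1.\<close>

lemma admits_competitive_proportion_tendsto_1:
  assumes "(\<lambda>n::nat. matroid_proportion {1..n} (paving {1..n})) \<longlonglongrightarrow> 1"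
  shows "(\<lambda>n. matroid_proportion {1..n}
    (admits_competitive_algorithm (1 + 1 / real (Suc M)) {1..n})) \<longlonglongrightarrow> 1"
proof -
  define k where "k = 4 * (5 * (M + 2)) ^ 4"
  let ?adm = "\<lambda>n::nat. matroid_proportion {1..n} (admits_competitive_algorithm (1 + 1 / real (Suc M)) {1..n})"
  let ?low = "\<lambda>n::nat. matroid_proportion {1..n} (\<lambda>\<I>. matroid_rank \<I> \<le> k)"
  have lower: "(\<lambda>n. matroid_proportion {1..n} (paving {1..n}) - ?low n) \<longlonglongrightarrow> 1"
    using tendsto_diff[OF assms low_rank_proportion_tendsto_0[of k]] by simp
  have "matroid_proportion {1..n} (paving {1..n}) \<le> ?low n + ?adm n" for n :: nat
  proof (rule matroid_proportion_disj)
    fix \<I> assume I: "matroid {1..n} \<I>" "paving {1..n} \<I>"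
    have "admits_competitive_algorithm (1 + 1 / real (Suc M)) {1..n} \<I>" if "\<not> matroid_rank \<I> \<le> k"
      using that by (intro paving_admits_competitive_algorithm I) (simp only: k_def not_le)
    then show "matroid_rank \<I> \<le> k \<or> admits_competitive_algorithm (1 + 1 / real (Suc M)) {1..n} \<I>"
      by argo
  qed simp
  then have "matroid_proportion {1..n} (paving {1..n}) - ?low n \<le> ?adm n" for n :: nat
    by (simp only: diff_le_eq add.commute)
  moreover have "?adm n \<le> 1" for n :: nat
    by (rule matroid_proportion_le_1) simp
  ultimately show ?thesis
    by (intro tendsto_sandwich[OF _ _ lower tendsto_const] always_eventually allI)
qed

text \<open>Level \<open>M\<close> is adopted only once its own error stays below
  \<open>1 / real (Suc M)\<close>; \<open>f n\<close> is the highest level adopted by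
  \<open>n\<close>.\<close>

lemma diagonal_tendsto:
  fixes P :: "nat \<Rightarrow> nat \<Rightarrow> real"
  assumes "\<And>M. P M \<longlonglongrightarrow> l"
  obtains f where "filterlim f at_top sequentially" "(\<lambda>n. P (f n) n) \<longlonglongrightarrow> l"
proof -
  have "\<exists>N. \<forall>n\<ge>N. \<bar>P M n - l\<bar> < 1 / real (Suc M)" for M
    using LIMSEQ_D[OF assms, of "1 / real (Suc M)" M] by simp
  then have "\<exists>N. \<forall>M. \<forall>n\<ge>N M. \<bar>P M n - l\<bar> < 1 / real (Suc M)"
    by (intro choice allI)
  then obtain N where N: "\<And>M n. N M \<le> n \<Longrightarrow> \<bar>P M n - l\<bar> < 1 / real (Suc M)"
    by blast
  \<comment> \<open>The bound \<open>M \<le> n\<close> keeps the set finite even if \<open>N\<close>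
    is bounded.\<close>
  define f where "f n = Max {M. M \<le> n \<and> N M \<le> n}" for n
  have fin: "finite {M. M \<le> n \<and> N M \<le> n}" for n
    by simp
  have ge: "M \<le> f n" if "M \<le> n" "N M \<le> n" for M n
    unfolding f_def using that by (intro Max_ge fin) simp
  have f: "filterlim f at_top sequentially"
    unfolding filterlim_at_top
  proof
    fix M
    show "\<forall>\<^sub>F n in sequentially. M \<le> f n"
      using eventually_ge_at_top[of M] eventually_ge_at_top[of "N M"]
      by eventually_elim (rule ge)
  qed
  \<comment> \<open>For smaller \<open>n\<close> the set may be empty and its \<open>Max\<close>
    unspecified.\<close>
  have "N (f n) \<le> n" if "N 0 \<le> n" for n
  proof -
    have "{M. M \<le> n \<and> N M \<le> n} \<noteq> {}"
      using that by auto
    then show ?thesis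
      using Max_in[OF fin] unfolding f_def by blast
  qed
  then have "\<forall>\<^sub>F n in sequentially. norm (P (f n) n - l) \<le> 1 / real (Suc (f n))"
    using N by (intro eventually_sequentiallyI[of "N 0"]) (simp add: less_imp_le)
  moreover have "(\<lambda>n. 1 / real (Suc (f n))) \<longlonglongrightarrow> 0"
    using filterlim_compose[OF LIMSEQ_Suc[OF lim_1_over_n] f] by simp
  ultimately have "(\<lambda>n. P (f n) n - l) \<longlonglongrightarrow> 0"
    by (rule Lim_null_comparison)
  then have "(\<lambda>n. P (f n) n) \<longlonglongrightarrow> l"
    by (rule LIM_zero_cancel)
  then show ?thesis
    by (rule that[OF f])
qed

theorem theorem1p4:
  assumes "(\<lambda>n::nat. matroid_proportion {1..n} (paving {1..n})) \<longlonglongrightarrow> 1"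
  shows "\<exists>\<epsilon> :: nat \<Rightarrow> real. (\<forall>n. 0 \<le> \<epsilon> n) \<and> \<epsilon> \<longlonglongrightarrow> 0 \<and>
    (\<lambda>n. matroid_proportion {1..n} (admits_competitive_algorithm (1 + \<epsilon> n) {1..n})) \<longlonglongrightarrow> 1"
proof -
  \<comment> \<open>Each fixed accuracy \<open>1 / real (Suc M)\<close> is reached in the limit;
    letting \<open>M\<close> grow slowly with \<open>n\<close> yields \<epsilon>.\<close>
  obtain f where f: "filterlim f at_top sequentially" "(\<lambda>n. matroid_proportion {1..n}
      (admits_competitive_algorithm (1 + 1 / real (Suc (f n))) {1..n})) \<longlonglongrightarrow> 1"
    by (rule diagonal_tendsto[OF admits_competitive_proportion_tendsto_1[OF assms]])
  have "(\<lambda>n. 1 / real (Suc (f n))) \<longlonglongrightarrow> 0"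
    using filterlim_compose[OF LIMSEQ_Suc[OF lim_1_over_n] f(1)] by simp
  then show ?thesis
    using f(2) by (intro exI[of _ "\<lambda>n. 1 / real (Suc (f n))"]) simp
qed

end
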